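(* Let $G=(V,E)$ be a simple connected graph with $V=\{1,\dots,n\}$ and adjacency matrix $A\in\mathbb{R}^{n\times n}$, and let $f$ be a scalar function defined on the spectrum of $A$. Let $$\mathbb{L}(f)=\operatorname{diag}(f(A)\mathbf{1})-f(A)$$ be the associated $k$-walk transformed Laplacian. Then: \begin{itemize} \item $\mathbb{L}(f)$ is symmetric, i.e. $\mathbb{L}(f)^\top=\mathbb{L}(f)$; \item $\mathbb{L}(f)\mathbf{1}=\mathbf{0}$; and \item if $f(A)\geq 0$ entrywise, then $\mathbb{L}(f)$ is an M-matrix. \end{itemize}
   Context: A simple graph is a finite, unweighted, undirected graph with no loops and no repeated edges; its adjacency matrix $A$ has $A_{ij}=1$ if $(i,j)\in E$ and $A_{ij}=0$ otherwise, so $A$ is real symmetric with zero diagonal. Connected means that any two nodes are joined by a walk. $\mathbf{1},\mathbf{0}\in\mathbb{R}^n$ are the column vectors of all ones and all zeros. For a vector $\mathbf{v}$, $\operatorname{diag}(\mathbf{v})$ is the diagonal matrix with the entries of $\mathbf{v}$ on its diagonal. $f(A)$ is the usual matrix function; "defined on the spectrum of $A$" is meant in the standard sense. Since $A$ is symmetric, hence diagonalizable, this means that $f(\lambda)$ exists for every eigenvalue $\lambda$ of $A$, and if $A=Q\Lambda Q^\top$ with $Q$ real orthogonal and $\Lambda=\operatorname{diag}(\lambda_1,\dots,\lambda_n)$, then $f(A)=Q\operatorname{diag}(f(\lambda_1),\dots,f(\lambda_n))Q^\top$. A matrix $M\in\mathbb{R}^{n\times n}$ is a $Z$-matrix if $M_{ij}\le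 0$ for all $i\ne j$. It is an M-matrix if it is a $Z$-matrix and every eigenvalue $\lambda$ of $M$ satisfies $\operatorname{Re}(\lambda)\ge 0$ (so singular M-matrices are allowed). *)

theory Defs
  imports
    "Graph_Theory.Graph_Theory"
    "Jordan_Normal_Form.Spectral_Radius"
begin

(* A simple graph is a pair_graph: finite, loop-free, and each undirected edge {u,v} is
   represented by the two arcs (u,v) and (v,u). Vertices are 1,...,n whereas matrix
   indices start at 0, so row i belongs to vertex Suc i. *)
definition adjacency_mat :: "nat \<Rightarrow> nat pair_pre_digraph \<Rightarrow> real mat" where
  "adjacency_mat n G = mat n n (\<lambda>(i, j). if (Suc i, Suc j) \<in> parcs G then 1 else 0)"

abbreviation ones_vec :: "nat \<Rightarrow> real vec" where
  "ones_vec n \<equiv> vec n (\<lambda>_. 1)"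

abbreviation diag_of_vec :: "real vec \<Rightarrow> real mat" where
  "diag_of_vec v \<equiv> mat_diag (dim_vec v) (\<lambda>i. v $ i)"

(* The library's orthogonal_mat only asks for pairwise orthogonal, not orthonormal, columns. *)
definition real_orthogonal :: "nat \<Rightarrow> real mat \<Rightarrow> bool" where
  "real_orthogonal n Q \<longleftrightarrow> Q \<in> carrier_mat n n \<and> transpose_mat Q * Q = 1\<^sub>m n"

definition orth_diagonalization :: "real mat \<Rightarrow> real mat \<Rightarrow> (nat \<Rightarrow> real) \<Rightarrow> bool" where
  "orth_diagonalization A Q l \<longleftrightarrow>
     real_orthogonal (dim_row A) Q \<and> A = Q * mat_diag (dim_row A) l * transpose_mat Q"

(* Scalar functions are partial maps, so that being defined at a point is a real condition. *)
definition defined_on_spectrum :: "(real \<rightharpoonup> real) \<Rightarrow> real mat \<Rightarrow> bool" where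
  "defined_on_spectrum f A \<longleftrightarrow> spectrum A \<subseteq> dom f"

(* Intended for symmetric A and f defined on the spectrum of A; the value does not depend on
   the chosen diagonalization, see matrix_fun_eq below. *)
definition matrix_fun :: "(real \<rightharpoonup> real) \<Rightarrow> real mat \<Rightarrow> real mat" where
  "matrix_fun f A = (THE B. \<exists>Q l. orth_diagonalization A Q l \<and>
     B = Q * mat_diag (dim_row A) (\<lambda>i. the (f (l i))) * transpose_mat Q)"

definition walk_laplacian :: "(real \<rightharpoonup> real) \<Rightarrow> real mat \<Rightarrow> real mat" where
  "walk_laplacian f A =
     diag_of_vec (matrix_fun f A *\<^sub>v ones_vec (dim_row A)) - matrix_fun f A"

definition nonneg_entries :: "real mat \<Rightarrow> bool" where
  "nonneg_entries M \<longleftrightarrow> (\<forall>i < dim_row M. \<forall>j < dim_col M. 0 \<le> M $$ (i, j))"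

definition Z_matrix :: "real mat \<Rightarrow> bool" where
  "Z_matrix M \<longleftrightarrow> square_mat M \<and>
     (\<forall>i < dim_row M. \<forall>j < dim_col M. i \<noteq> j \<longrightarrow> M $$ (i, j) \<le> 0)"

(* Eigenvalues range over the complex numbers, hence the embedding. *)
definition M_matrix :: "real mat \<Rightarrow> bool" where
  "M_matrix M \<longleftrightarrow> Z_matrix M \<and>
     (\<forall>z. eigenvalue (map_mat complex_of_real M) z \<longrightarrow> 0 \<le> Re z)"

lemma orth_diagonalization_unique:
  assumes "orth_diagonalization A Q l" and "orth_diagonalization A P m"
  defines "n \<equiv> dim_row A"
  shows "Q * mat_diag n (\<lambda>i. g (l i)) * transpose_mat Q
       = P * mat_diag n (\<lambda>i. g (m i)) * transpose_mat P"
proof -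
  have Q: "Q \<in> carrier_mat n n" and P: "P \<in> carrier_mat n n"
    and QQ: "transpose_mat Q * Q = 1\<^sub>m n" and PP: "transpose_mat P * P = 1\<^sub>m n"
    and AQ: "A = Q * mat_diag n l * transpose_mat Q"
    and AP: "A = P * mat_diag n m * transpose_mat P"
    using assms by (auto simp: orth_diagonalization_def real_orthogonal_def)
  have Qt: "transpose_mat Q \<in> carrier_mat n n" and Pt: "transpose_mat P \<in> carrier_mat n n"
    using Q P by auto
  have PP': "P * transpose_mat P = 1\<^sub>m n"
    using mat_mult_left_right_inverse[OF Pt P PP] .
  define W where "W = transpose_mat P * Q"
  have W: "W \<in> carrier_mat n n" using Q Pt by (simp add: W_def)
  have D: "mat_diag n h \<in> carrier_mat n n" for h :: "nat \<Rightarrow> real" by simp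
  note assoc = assoc_mult_mat[of _ n n _ n _ n] mult_carrier_mat[of _ n n _ n]
  have "W * mat_diag n l = transpose_mat P * (Q * mat_diag n l * (transpose_mat Q * Q))"
    unfolding QQ W_def right_mult_one_mat[OF mult_carrier_mat[OF Q D]]
    using Q Pt D[of l] by (simp add: assoc)
  also have "\<dots> = transpose_mat P * (A * Q)"
    unfolding AQ using Q Qt D[of l] by (simp add: assoc)
  also have "\<dots> = (transpose_mat P * P) * (mat_diag n m * W)"
    unfolding AP W_def using Q Pt P D[of m] by (simp add: assoc)
  also have "\<dots> = mat_diag n m * W"
    unfolding PP by (rule left_mult_one_mat[OF mult_carrier_mat[OF D W]])
  finally have comm: "W * mat_diag n l = mat_diag n m * W" .
  have entry: "W $$ (i, j) * g (l j) = g (m i) * W $$ (i, j)" if ij: "i < n" "j < n" for i j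
  proof (cases "W $$ (i, j) = 0")
    case False
    have "W $$ (i, j) * l j = m i * W $$ (i, j)"
      using arg_cong[OF comm, of "\<lambda>X. X $$ (i, j)"] ij
      by (simp add: mat_diag_mult_left[OF W] mat_diag_mult_right[OF W])
    with False have "l j = m i" by simp
    then show ?thesis by simp
  qed simp
  have comm': "W * mat_diag n (\<lambda>i. g (l i)) = mat_diag n (\<lambda>i. g (m i)) * W"
    unfolding mat_diag_mult_left[OF W] mat_diag_mult_right[OF W]
    by (rule eq_matI) (auto simp: entry)
  let ?L = "mat_diag n (\<lambda>i. g (l i))" and ?M = "mat_diag n (\<lambda>i. g (m i))"
  have "Q * ?L * transpose_mat Q = (P * transpose_mat P) * (Q * ?L * transpose_mat Q)"
    unfolding PP'
    by (rule left_mult_one_mat[OF mult_carrier_mat[OF mult_carrier_mat[OF Q D] Qt], symmetric])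
  also have "\<dots> = P * ((W * ?L) * transpose_mat Q)"
    unfolding W_def using P Pt Q Qt D[of "\<lambda>i. g (l i)"]
    by (simp add: assoc)
  also have "\<dots> = P * ?M * (transpose_mat P * (Q * transpose_mat Q))"
    unfolding comm' unfolding W_def using P Pt Q Qt D[of "\<lambda>i. g (m i)"]
    by (simp add: assoc)
  also have "\<dots> = P * ?M * transpose_mat P"
    unfolding mat_mult_left_right_inverse[OF Qt Q QQ] using Pt by simp
  finally show ?thesis .
qed

lemma matrix_fun_eq:
  assumes "orth_diagonalization A Q l"
  shows "matrix_fun f A = Q * mat_diag (dim_row A) (\<lambda>i. the (f (l i))) * transpose_mat Q"
  unfolding matrix_fun_def
proof (rule the_equality)
  fix B
  assume "\<exists>P m. orth_diagonalization A P m \<and>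
    B = P * mat_diag (dim_row A) (\<lambda>i. the (f (m i))) * transpose_mat P"
  then show "B = Q * mat_diag (dim_row A) (\<lambda>i. the (f (l i))) * transpose_mat Q"
    using orth_diagonalization_unique[OF _ assms, where g = "\<lambda>x. the (f x)"] by auto
qed (use assms in blast)

end

theory Submission
  imports Defs
begin

text \<open>
  The adjacency matrix is real symmetric, so by the spectral theorem (deflation: split off a unit
  eigenvector and recurse on its orthogonal complement) f(A) is given by an orthogonal
  diagonalization and is itself symmetric. Since the diagonal of the Laplacian is made of the row
  sums of f(A), its rows sum to zero. If f(A) is nonnegative, each Gershgorin disc of the Laplacian
  is contained in a disc centred at some d \<open>\<ge> 0\<close> with radius d, hence in the right half plane.
\<close>

section \<open>The spectral theorem for real symmetric matrices\<close>

text \<open>For an eigenvector \<open>v\<close>, the Hermitian form v* A v equals \<open>z\<close>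
  times the squared norm of \<open>v\<close>. The form is real because \<open>A\<close> is real and
  symmetric, and the norm is nonzero, so \<open>z\<close> equals its conjugate.\<close>

lemma real_symmetric_eigenvalue_real:
  fixes A :: "real mat"
  assumes A: "A \<in> carrier_mat n n" and sym: "transpose_mat A = A"
    and ev: "eigenvalue (map_mat complex_of_real A) z"
  shows "z \<in> \<real>"
proof -
  let ?C = "map_mat complex_of_real A"
  obtain v where v: "v \<in> carrier_vec n" "v \<noteq> 0\<^sub>v n" and eq: "?C *\<^sub>v v = z \<cdot>\<^sub>v v"
    using ev A unfolding eigenvalue_def eigenvector_def by auto
  have row: "(\<Sum>j<n. of_real (A $$ (i, j)) * v $ j) = z * v $ i" if "i < n" for i
    using arg_cong[OF eq, of "\<lambda>w. w $ i"] that A v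
    by (simp add: scalar_prod_def atLeast0LessThan)
  have symE: "A $$ (i, j) = A $$ (j, i)" if "i < n" "j < n" for i j
    using arg_cong[OF sym, of "\<lambda>M. M $$ (i, j)"] that A by simp
  define N where "N = (\<Sum>i<n. cnj (v $ i) * v $ i)"
  define S where "S = (\<Sum>i<n. cnj (v $ i) * (\<Sum>j<n. of_real (A $$ (i, j)) * v $ j))"
  have S: "S = z * N"
    unfolding S_def N_def sum_distrib_left[of z] by (rule sum.cong) (auto simp: row)
  have Nreal: "N = of_real (\<Sum>i<n. (cmod (v $ i))\<^sup>2)"
    unfolding N_def of_real_sum by (rule sum.cong) (simp_all only: complex_norm_square mult.commute)
  \<comment> \<open>Conjugation fixes the entries of \<open>A\<close> and exchanges the roles of the
    two copies of \<open>v\<close>. Swapping the sums and using the symmetry of \<open>A\<close>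
    undoes this exchange.\<close>
  have "cnj S = (\<Sum>i<n. \<Sum>j<n. of_real (A $$ (i, j)) * v $ i * cnj (v $ j))"
    unfolding S_def by (simp add: sum_distrib_left mult_ac)
  also have "\<dots> = (\<Sum>j<n. \<Sum>i<n. of_real (A $$ (i, j)) * v $ i * cnj (v $ j))"
    by (rule sum.swap)
  also have "\<dots> = S"
    unfolding S_def by (auto simp: sum_distrib_left mult_ac symE intro!: sum.cong)
  finally have "cnj S = S" .
  then have "cnj z * N = z * N"
    unfolding S Nreal by simp
  moreover have "N \<noteq> 0"
  proof -
    obtain i where "i < n" "v $ i \<noteq> 0"
      using v by (metis carrier_vecD eq_vecI index_zero_vec)
    then have "(\<Sum>i<n. (cmod (v $ i))\<^sup>2) > 0"
      by (intro sum_pos2[of _ i]) auto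
    then show ?thesis
      unfolding Nreal by (metis less_irrefl of_real_eq_0_iff)
  qed
  ultimately show ?thesis
    using Reals_cnj_iff by auto
qed

text \<open>A complex eigenvalue exists and is real by the previous lemma. Since the characteristic
  polynomial has real coefficients, its complex root is the image of a real root.\<close>

lemma real_symmetric_has_eigenvalue:
  fixes A :: "real mat"
  assumes A: "A \<in> carrier_mat n n" and sym: "transpose_mat A = A" and n: "n \<noteq> 0"
  shows "\<exists>x. eigenvalue A x"
proof -
  let ?C = "map_mat complex_of_real A"
  have C: "?C \<in> carrier_mat n n" using A by simp
  obtain z where z: "eigenvalue ?C z"
    using spectrum_non_empty[OF C] n unfolding spectrum_def by auto
  obtain x where x: "z = of_real x"
    using real_symmetric_eigenvalue_real[OF A sym z] by (auto elim: Reals_cases)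
  have "poly (map_poly complex_of_real (char_poly A)) (of_real x) = 0"
    using z unfolding eigenvalue_root_char_poly[OF C] x of_real_hom.char_poly_hom[OF A] .
  then have "poly (char_poly A) x = 0"
    by simp
  then show ?thesis
    using eigenvalue_root_char_poly[OF A] by auto
qed

text \<open>Supplies the change of basis for deflation: complete \<open>v\<close> to a basis, apply
  Gram-Schmidt, which keeps the head \<open>v\<close>, and normalize. The scalar \<open>c\<close> is
  the reciprocal of the norm of \<open>v\<close>.\<close>

lemma orthogonal_with_first_column:
  fixes v :: "real vec"
  assumes v: "v \<in> carrier_vec n" "v \<noteq> 0\<^sub>v n"
  shows "\<exists>W c. real_orthogonal n W \<and> col W 0 = c \<cdot>\<^sub>v v"
proof -
  interpret cof_vec_space n "TYPE(real)" .
  have n: "0 < n"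
    using v by (metis carrier_vecD eq_vecI gr0I index_zero_vec(2) not_less_zero)
  let ?b = "basis_completion v"
  define ws where "ws = gram_schmidt n ?b"
  note b = basis_completion[OF v]
  have ws: "set ws \<subseteq> carrier_vec n" "corthogonal ws" "length ws = n"
    using gram_schmidt_result[OF b(2,4,5) refl] b(6) unfolding ws_def by auto
  obtain vs where "?b = v # vs"
    using b(6,7) n by (cases ?b) auto
  with gram_schmidt_hd[OF v(1), of vs] have "hd ws = v"
    unfolding ws_def by simp
  with ws(3) n have ws0: "ws ! 0 = v"
    by (simp add: hd_conv_nth[symmetric] flip: length_greater_0_conv)
  have wsi: "ws ! i \<in> carrier_vec n" if "i < n" for i
    using ws that by auto
  define r where "r j = sqrt (ws ! j \<bullet> ws ! j)" for j
  define W where "W = mat n n (\<lambda>(i, j). ws ! j $ i / r j)"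
  \<comment> \<open>The case \<open>i = j\<close> says that no basis vector has norm zero, which
    makes the divisions by \<open>r j\<close> legitimate.\<close>
  have orth: "(ws ! i \<bullet> ws ! j = 0) = (i \<noteq> j)" if "i < n" "j < n" for i j
    using corthogonalD[OF ws(2)] that ws(3) by simp
  have rr: "r j * r j = ws ! j \<bullet> ws ! j" for j
    unfolding r_def by (simp add: scalar_prod_def sum_nonneg)
  have colW: "col W j = (1 / r j) \<cdot>\<^sub>v ws ! j" if "j < n" for j
    using that wsi[OF that] by (intro eq_vecI) (auto simp: W_def)
  have W: "W \<in> carrier_mat n n" by (simp add: W_def)
  have "transpose_mat W * W = 1\<^sub>m n"
  proof (rule eq_matI)
    fix i j assume ij: "i < dim_row (1\<^sub>m n)" "j < dim_col (1\<^sub>m n)"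
    then have "(transpose_mat W * W) $$ (i, j) = (ws ! i \<bullet> ws ! j) / (r i * r j)"
      using W wsi[of i] wsi[of j] by (simp add: colW)
    also have "\<dots> = 1\<^sub>m n $$ (i, j)"
      using ij orth[of i j] by (auto simp: rr)
    finally show "(transpose_mat W * W) $$ (i, j) = 1\<^sub>m n $$ (i, j)" .
  qed (use W in auto)
  then show ?thesis
    using W colW[OF n] ws0 unfolding real_orthogonal_def by auto
qed

lemma real_orthogonal_mult:
  assumes "real_orthogonal n P" and "real_orthogonal n Q"
  shows "real_orthogonal n (P * Q)"
proof -
  have P: "P \<in> carrier_mat n n" and Q: "Q \<in> carrier_mat n n"
    and PP: "transpose_mat P * P = 1\<^sub>m n" and QQ: "transpose_mat Q * Q = 1\<^sub>m n"
    using assms unfolding real_orthogonal_def by auto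
  have "transpose_mat (P * Q) * (P * Q) = transpose_mat Q * ((transpose_mat P * P) * Q)"
    using P Q by (simp add: transpose_mult[of _ n n _ n] assoc_mult_mat[of _ n n _ n _ n]
        mult_carrier_mat[of _ n n _ n])
  also have "\<dots> = 1\<^sub>m n"
    unfolding PP using Q QQ by simp
  finally show ?thesis
    using P Q unfolding real_orthogonal_def by auto
qed

lemma real_symmetric_orth_diagonalization:
  assumes "A \<in> carrier_mat n n" and "transpose_mat A = A"
  shows "\<exists>Q l. orth_diagonalization A Q l"
  using assms
proof (induction n arbitrary: A)
  case 0
  have "orth_diagonalization A (1\<^sub>m 0) (\<lambda>_. 0)"
    unfolding orth_diagonalization_def real_orthogonal_def
    using 0 by (auto intro!: eq_matI)
  then show ?case by blast
next
  case (Suc m)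
  let ?n = "Suc m"
  note A = Suc.prems(1) and sym = Suc.prems(2)
  obtain e v where v: "v \<in> carrier_vec ?n" "v \<noteq> 0\<^sub>v ?n" and Av: "A *\<^sub>v v = e \<cdot>\<^sub>v v"
    using real_symmetric_has_eigenvalue[OF A sym] A unfolding eigenvalue_def eigenvector_def by auto
  obtain W c where W: "real_orthogonal ?n W" and col0: "col W 0 = c \<cdot>\<^sub>v v"
    using orthogonal_with_first_column[OF v] by blast
  from W have Wc: "W \<in> carrier_mat ?n ?n" and WtW: "transpose_mat W * W = 1\<^sub>m ?n"
    unfolding real_orthogonal_def by auto
  have Wtc: "transpose_mat W \<in> carrier_mat ?n ?n" using Wc by simp
  have WWt: "W * transpose_mat W = 1\<^sub>m ?n"
    using mat_mult_left_right_inverse[OF Wtc Wc WtW] .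
  note assoc = assoc_mult_mat[of _ ?n ?n _ ?n _ ?n] mult_carrier_mat[of _ ?n ?n _ ?n]
  \<comment> \<open>\<open>B\<close> is \<open>A\<close> expressed in the orthonormal basis of the
    columns of \<open>W\<close>, whose first member is an eigenvector for \<open>e\<close>.\<close>
  define B where "B = transpose_mat W * (A * W)"
  have B: "B \<in> carrier_mat ?n ?n"
    unfolding B_def using A Wc by auto
  have symB: "transpose_mat B = B"
    unfolding B_def using A Wc Wtc sym by (simp add: transpose_mult[of _ ?n ?n _ ?n] assoc)
  have symBE: "B $$ (i, j) = B $$ (j, i)" if "i < ?n" "j < ?n" for i j
    using arg_cong[OF symB, of "\<lambda>M. M $$ (i, j)"] that B by simp
  have "A *\<^sub>v col W 0 = e \<cdot>\<^sub>v col W 0"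
    unfolding col0 using A v Av
    by (simp add: mult_mat_vec smult_smult_assoc mult.commute)
  then have "col (A * W) 0 = e \<cdot>\<^sub>v col W 0"
    using A Wc by (simp add: col_mult2[of _ ?n ?n _ ?n] del: col_mult)
  \<comment> \<open>The first column of \<open>B\<close> is \<open>e\<close> times
    \<open>transpose_mat W *\<^sub>v col W 0\<close>, that is, \<open>e\<close> times the first unit
    vector. By \<open>symBE\<close> the first row has the same form, so only the block
    \<open>D\<close> remains to be diagonalized.\<close>
  then have B0: "B $$ (i, 0) = (if i = 0 then e else 0)" if "i < ?n" for i
    using that arg_cong[OF WtW, of "\<lambda>M. M $$ (i, 0)"] A Wc unfolding B_def by simp
  define D where "D = mat m m (\<lambda>(i, j). B $$ (Suc i, Suc j))"
  have D: "D \<in> carrier_mat m m" by (simp add: D_def)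
  have "transpose_mat D = D"
    by (rule eq_matI) (auto simp: D_def symBE)
  from Suc.IH[OF D this] obtain Q l where "orth_diagonalization D Q l" by blast
  then have Q: "Q \<in> carrier_mat m m" and QtQ: "transpose_mat Q * Q = 1\<^sub>m m"
    and DQ: "D = Q * mat_diag m l * transpose_mat Q"
    unfolding orth_diagonalization_def real_orthogonal_def using D by auto
  let ?E = "1\<^sub>m 1 :: real mat" and ?R = "0\<^sub>m 1 m :: real mat" and ?S = "0\<^sub>m m 1 :: real mat"
  \<comment> \<open>\<open>P\<close> fixes the split-off eigenvector and acts as \<open>Q\<close> on
    its complement. Correspondingly, \<open>k\<close> puts \<open>e\<close> at index 0 and shifts
    the eigenvalues \<open>l\<close> of \<open>D\<close> by one.\<close>
  define P where "P = four_block_mat ?E ?R ?S Q"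
  define k where "k = case_nat e l"
  have P: "P \<in> carrier_mat ?n ?n"
    unfolding P_def using four_block_carrier_mat[of ?E 1 1 Q m m ?R ?S] Q by simp
  have Pt: "transpose_mat P = four_block_mat ?E ?R ?S (transpose_mat Q)"
    unfolding P_def
    by (subst transpose_four_block_mat[of _ 1 1 _ m _ m]) (use Q in auto)
  have "transpose_mat P * P = four_block_mat ?E ?R ?S (1\<^sub>m m)"
    unfolding Pt unfolding P_def
    by (subst mult_four_block_mat[of _ 1 1 _ m _ m _ _ 1 _ m]) (use Q QtQ in auto)
  also have "\<dots> = 1\<^sub>m ?n"
    by (rule eq_matI) auto
  finally have Porth: "real_orthogonal ?n P"
    unfolding real_orthogonal_def using P by simp
  have K: "mat_diag ?n k = four_block_mat (mat_diag 1 (\<lambda>_. e)) ?R ?S (mat_diag m l)"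
    by (rule eq_matI) (auto simp: mat_diag_def k_def split: nat.splits)
  have "P * mat_diag ?n k = four_block_mat (mat_diag 1 (\<lambda>_. e)) ?R ?S (Q * mat_diag m l)"
    unfolding P_def K
    by (subst mult_four_block_mat[of _ 1 1 _ m _ m _ _ 1 _ m])
       (use Q mat_diag_dim[of m l] mat_diag_dim[of 1 "\<lambda>_. e"] in \<open>auto simp del: mat_diag_dim\<close>)
  then have "P * mat_diag ?n k * transpose_mat P
      = four_block_mat (mat_diag 1 (\<lambda>_. e)) ?R ?S D"
    unfolding Pt DQ
    by (simp, subst mult_four_block_mat[of _ 1 1 _ m _ m _ _ 1 _ m])
       (use Q mat_diag_dim[of m l] mat_diag_dim[of 1 "\<lambda>_. e"] in \<open>auto simp del: mat_diag_dim\<close>)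
  also have "\<dots> = B"
  proof (rule eq_matI)
    fix i j assume ij: "i < dim_row B" "j < dim_col B"
    then show "four_block_mat (mat_diag 1 (\<lambda>_. e)) ?R ?S D $$ (i, j) = B $$ (i, j)"
      using B B0[of i] B0[of j] symBE[of i j]
      by (cases i; cases j) (auto simp: D_def mat_diag_def)
  qed (use B in \<open>auto simp: D_def mat_diag_def\<close>)
  finally have PB: "P * mat_diag ?n k * transpose_mat P = B" .
  have kc: "mat_diag ?n k \<in> carrier_mat ?n ?n" by simp
  \<comment> \<open>Undo the change of basis: \<open>W * P\<close> diagonalizes \<open>A\<close>
    because \<open>P\<close> diagonalizes \<open>B\<close>.\<close>
  have "(W * P) * mat_diag ?n k * transpose_mat (W * P)
      = W * (P * mat_diag ?n k * transpose_mat P) * transpose_mat W"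
    using Wc Wtc P kc by (simp add: transpose_mult[of _ ?n ?n _ ?n] assoc)
  also have "\<dots> = (W * transpose_mat W) * A * (W * transpose_mat W)"
    unfolding PB B_def using Wc Wtc A by (simp add: assoc)
  also have "\<dots> = A"
    unfolding WWt using A by simp
  finally have "orth_diagonalization A (W * P) k"
    unfolding orth_diagonalization_def using A real_orthogonal_mult[OF W Porth] by simp
  then show ?case by blast
qed

section \<open>Functions of symmetric matrices\<close>

text \<open>The spectral theorem provides a diagonalization, so the definite description in
  \<open>matrix_fun\<close> can be replaced by Q D Q^T with \<open>D\<close> diagonal, a form
  invariant under transposition.\<close>

lemma matrix_fun_symmetric:
  assumes A: "A \<in> carrier_mat n n" and sym: "transpose_mat A = A"
  shows "matrix_fun f A \<in> carrier_mat n n"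
    and "transpose_mat (matrix_fun f A) = matrix_fun f A"
proof -
  obtain Q l where Ql: "orth_diagonalization A Q l"
    using real_symmetric_orth_diagonalization[OF assms] by blast
  then have Q: "Q \<in> carrier_mat n n"
    using A unfolding orth_diagonalization_def real_orthogonal_def by auto
  define D where "D = mat_diag n (\<lambda>i. the (f (l i)))"
  have D: "D \<in> carrier_mat n n" and symD: "transpose_mat D = D"
    unfolding D_def by (auto simp: mat_diag_def intro!: eq_matI)
  have eq: "matrix_fun f A = Q * D * transpose_mat Q"
    unfolding D_def using matrix_fun_eq[OF Ql] A by simp
  show "matrix_fun f A \<in> carrier_mat n n"
    unfolding eq using Q D by auto
  show "transpose_mat (matrix_fun f A) = matrix_fun f A"
    unfolding eq using Q D symD
    by (simp add: transpose_mult[of _ n n _ n] assoc_mult_mat[of _ n n _ n _ n]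
        mult_carrier_mat[of _ n n _ n])
qed

section \<open>Laplacians\<close>

text \<open>The diagonal of the Laplacian carries the row sums of \<open>F\<close>. This entrywise
  form is the basis of the symmetry, kernel and sign arguments.\<close>

lemma laplacian_index:
  fixes F :: "real mat"
  assumes "F \<in> carrier_mat n n" and "i < n" and "j < n"
  shows "(diag_of_vec (F *\<^sub>v ones_vec n) - F) $$ (i, j)
    = (if i = j then \<Sum>k<n. F $$ (i, k) else 0) - F $$ (i, j)"
  using assms by (auto simp: mat_diag_def scalar_prod_def atLeast0LessThan)

lemma laplacian_mult_ones:
  fixes F :: "real mat"
  assumes F: "F \<in> carrier_mat n n"
  shows "(diag_of_vec (F *\<^sub>v ones_vec n) - F) *\<^sub>v ones_vec n = 0\<^sub>v n"
proof (rule eq_vecI)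
  let ?L = "diag_of_vec (F *\<^sub>v ones_vec n) - F"
  fix i assume i: "i < dim_vec (0\<^sub>v n :: real vec)"
  have "(?L *\<^sub>v ones_vec n) $ i = (\<Sum>j<n. ?L $$ (i, j))"
    using F i by (simp add: scalar_prod_def atLeast0LessThan)
  also have "\<dots> = (\<Sum>j<n. (if i = j then \<Sum>k<n. F $$ (i, k) else 0) - F $$ (i, j))"
    using i by (intro sum.cong refl laplacian_index[OF F]) auto
  also have "\<dots> = 0"
    using i by (simp add: sum_subtractf)
  finally show "(?L *\<^sub>v ones_vec n) $ i = 0\<^sub>v n $ i"
    using i by simp
qed (use F in auto)

section \<open>Gershgorin discs and the M-matrix property\<close>

text \<open>Gershgorin's circle theorem. The disc is found in the row \<open>i\<close> where the
  eigenvector has its entry of largest modulus: there the off-diagonal terms of the eigenvalue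
  equation are bounded by that modulus times the radius.\<close>

lemma gershgorin:
  fixes A :: "complex mat"
  assumes A: "A \<in> carrier_mat n n" and ev: "eigenvalue A z"
  shows "\<exists>i<n. cmod (z - A $$ (i, i)) \<le> (\<Sum>j\<in>{..<n} - {i}. cmod (A $$ (i, j)))"
proof -
  obtain v where v: "v \<in> carrier_vec n" "v \<noteq> 0\<^sub>v n" and eq: "A *\<^sub>v v = z \<cdot>\<^sub>v v"
    using ev A unfolding eigenvalue_def eigenvector_def by auto
  obtain k where k: "k < n" "v $ k \<noteq> 0"
    using v by (metis carrier_vecD eq_vecI index_zero_vec)
  define M where "M = Max ((\<lambda>i. cmod (v $ i)) ` {..<n})"
  have "M \<in> (\<lambda>i. cmod (v $ i)) ` {..<n}"
    unfolding M_def using k by (intro Max_in) auto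
  then obtain i where i: "i < n" "M = cmod (v $ i)" by auto
  have le: "cmod (v $ j) \<le> M" if "j < n" for j
    unfolding M_def using that by simp
  \<comment> \<open>Positivity allows the factor \<open>M\<close> to be cancelled from both sides of
    the final estimate.\<close>
  have pos: "0 < M"
    using le[OF k(1)] k(2) by (meson less_le_trans zero_less_norm_iff)
  have "(\<Sum>j<n. A $$ (i, j) * v $ j) = z * v $ i"
    using arg_cong[OF eq, of "\<lambda>w. w $ i"] i A v by (simp add: scalar_prod_def atLeast0LessThan)
  moreover have "(\<Sum>j<n. A $$ (i, j) * v $ j)
      = A $$ (i, i) * v $ i + (\<Sum>j\<in>{..<n} - {i}. A $$ (i, j) * v $ j)"
    using i by (intro sum.remove) auto
  ultimately have "(z - A $$ (i, i)) * v $ i = (\<Sum>j\<in>{..<n} - {i}. A $$ (i, j) * v $ j)"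
    by (simp add: algebra_simps)
  then have "cmod (z - A $$ (i, i)) * M = cmod (\<Sum>j\<in>{..<n} - {i}. A $$ (i, j) * v $ j)"
    unfolding i(2) by (simp flip: norm_mult)
  also have "\<dots> \<le> (\<Sum>j\<in>{..<n} - {i}. cmod (A $$ (i, j)) * M)"
    by (intro sum_norm_le) (auto simp: norm_mult intro!: mult_left_mono le)
  finally show ?thesis
    using i(1) pos by (auto simp flip: sum_distrib_right)
qed

lemma laplacian_M_matrix:
  fixes F :: "real mat"
  assumes F: "F \<in> carrier_mat n n" and nonneg: "nonneg_entries F"
  shows "M_matrix (diag_of_vec (F *\<^sub>v ones_vec n) - F)" (is "M_matrix ?L")
proof -
  define L where "L = ?L"
  have L: "L \<in> carrier_mat n n" unfolding L_def using F by auto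
  have L_index: "L $$ (i, j) = (if i = j then \<Sum>k<n. F $$ (i, k) else 0) - F $$ (i, j)"
    if "i < n" "j < n" for i j
    unfolding L_def using laplacian_index[OF F that] .
  have F0: "0 \<le> F $$ (i, j)" if "i < n" "j < n" for i j
    using nonneg F that unfolding nonneg_entries_def by auto
  have "Z_matrix L"
    unfolding Z_matrix_def using L F
    by (auto simp: L_index F0)
  moreover have "0 \<le> Re z" if ev: "eigenvalue (map_mat complex_of_real L) z" for z
  proof -
    obtain i where i: "i < n" and disc: "cmod (z - map_mat complex_of_real L $$ (i, i))
        \<le> (\<Sum>j\<in>{..<n} - {i}. cmod (map_mat complex_of_real L $$ (i, j)))"
      using gershgorin[OF _ ev, of n] L by auto
    have ent: "map_mat complex_of_real L $$ (i, j) = of_real (L $$ (i, j))" if "j < n" for j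
      using L i that by (intro index_map_mat) auto
    \<comment> \<open>The term \<open>F $$ (i, i)\<close> cancels from the diagonal entry of
      \<open>L\<close>, leaving the sum of the other entries of that row of \<open>F\<close>. By
      nonnegativity this is also the Gershgorin radius.\<close>
    have "(\<Sum>j\<in>{..<n} - {i}. cmod (map_mat complex_of_real L $$ (i, j)))
        = (\<Sum>j\<in>{..<n} - {i}. F $$ (i, j))"
      using i by (intro sum.cong refl) (auto simp: ent L_index F0
          simp del: index_map_mat)
    also have "\<dots> = L $$ (i, i)"
      using i by (subst L_index) (auto simp: sum.remove[of _ i])
    finally have "cmod (z - of_real (L $$ (i, i))) \<le> L $$ (i, i)"
      using disc ent[OF i] by simp
    \<comment> \<open>The real part of \<open>z\<close> lies within distance
      \<open>L $$ (i, i)\<close> of \<open>L $$ (i, i)\<close> itself, so it cannot be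
      negative.\<close>
    moreover have "\<bar>Re z - L $$ (i, i)\<bar> \<le> cmod (z - of_real (L $$ (i, i)))"
      using abs_Re_le_cmod[of "z - of_real (L $$ (i, i))"] by simp
    ultimately show ?thesis by linarith
  qed
  ultimately show ?thesis
    unfolding M_matrix_def L_def by blast
qed

theorem proposition3:
  fixes n :: nat and G :: "nat pair_pre_digraph" and A :: "real mat" and f :: "real \<rightharpoonup> real"
  assumes "pair_graph G" and "pverts G = {1..n}" and "Digraph_Component.connected (with_proj G)"
    and "A = adjacency_mat n G"
    and "defined_on_spectrum f A"
  shows "transpose_mat (walk_laplacian f A) = walk_laplacian f A
    \<and> walk_laplacian f A *\<^sub>v ones_vec n = 0\<^sub>v n
    \<and> (nonneg_entries (matrix_fun f A) \<longrightarrow> M_matrix (walk_laplacian f A))"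
proof -
  interpret pair_graph G by fact
  have A: "A \<in> carrier_mat n n"
    unfolding assms(4) adjacency_mat_def by simp
  \<comment> \<open>The two arcs of each undirected edge make \<open>A\<close> symmetric, which
    opens the way to the spectral theorem.\<close>
  have "(v, u) \<in> parcs G \<longleftrightarrow> (u, v) \<in> parcs G" for u v
    using arcs_symmetric by blast
  then have sym: "transpose_mat A = A"
    unfolding assms(4) adjacency_mat_def by (intro eq_matI) auto
  define F where "F = matrix_fun f A"
  have F: "F \<in> carrier_mat n n" and symF: "transpose_mat F = F"
    unfolding F_def using matrix_fun_symmetric[OF A sym] by auto
  have symFE: "F $$ (i, j) = F $$ (j, i)" if "i < n" "j < n" for i j
    using arg_cong[OF symF, of "\<lambda>M. M $$ (i, j)"] that F by simp
  have L: "walk_laplacian f A = diag_of_vec (F *\<^sub>v ones_vec n) - F"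
    unfolding walk_laplacian_def F_def using A by simp
  have Lc: "walk_laplacian f A \<in> carrier_mat n n"
    unfolding L using F by auto
  have "walk_laplacian f A $$ (i, j) = walk_laplacian f A $$ (j, i)" if "i < n" "j < n" for i j
    unfolding L laplacian_index[OF F that] laplacian_index[OF F that(2,1)]
    using symFE[OF that] by simp
  then have "transpose_mat (walk_laplacian f A) = walk_laplacian f A"
    using Lc by (intro eq_matI) auto
  then show ?thesis
    using laplacian_mult_ones[OF F] laplacian_M_matrix[OF F] unfolding L F_def by blast
qed

end
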